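(* If the basic table is cyclic and $\psi$ is separable convex, i.e. $\psi(x)=\sum_{k\in\mathcal K}\psi_k(x_k)$ for $x\in\mathbb R_+^K$ with each $\psi_k:\mathbb R_+\to\mathbb R_+$ convex, then $q_{exh}$ is a solution to $$\min_{q_e\in\mathcal Q}\ \frac1{\tau_e}\int_0^{\tau_e}\psi(q_e(u))\,du,$$ where $\tau_e$ is the cycle length of $q_e$.
   Context: **Data.** $K\ge1$ queues $\mathcal K=\{1,\dots,K\}$; stages $\mathcal I=\{1,\dots,I\}$, $I\ge K$; a polling function (basic table) $p:\mathcal I\to\mathcal K$ in which every queue appears. The table is *cyclic* if every queue appears exactly once. Rates $\lambda_k,\mu_k\in(0,\infty)$, $\rho=\sum_k\lambda_k/\mu_k<1$. Switchover times $s_i\ge0$ ($i\in\mathcal I$), $s=\sum_i s_i>0$. For $L\in\mathbb N$, $\mathcal I^L=\{1,\dots,IL\}$ is the stage set of $L$ repetitions of the basic table, with $p$ and $s_i$ extended $I$-periodically; $\tau_L=sL/(1-\rho)$. The cost $\psi:\mathbb R_+^K\to\mathbb R_+$ is nondecreasing and continuous. **PE-candidates.** An $L$-cycle PE-candidate is a closed curve $q_e:[0,\tau_L]\to\mathbb R_+^K$, $q_e(0)=q_e(\tau_L)$, for which there are busy times $b_i\ge0$, $i\in\mathcal I^L$, such that, with stage 1 polled at time $0$: when stage $i$ is polled, queue $p(i)$ is served for time $b_i$, during which $\dot q_{e,p(i)}=\lambda_{p(i)}-\mu_{p(i)}$ and $\dot q_{e,k}=\lambda_k$ for $k\ne p(i)$;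 then the server switches for time $s_i$, during which $\dot q_{e,k}=\lambda_k$ for all $k$; then stage $i+1$ is polled, the cycle ending at time $\tau_L$ after stage $IL$ and its switchover. Its cycle length is $\tau_L$. $\mathcal Q$ is the set of all PE-candidates over all $L\in\mathbb N$. $q_{exh}$ is the one-cycle ($L=1$) PE-candidate under the exhaustive policy, in which the server empties the queue it attends at every stage and then switches to the next queue in the table. *)

theory Defs
  imports "HOL-Analysis.Analysis"
begin

text \<open>
  The queues are the elements of a finite type \<open>'k\<close>, so that \<open>K = CARD('k) \<ge> 1\<close> and
  \<open>\<real>\<^sup>K\<close> is \<open>real^'k\<close>.  Its order is the componentwise one, hence \<open>{0..}\<close>, read as a
  subset of \<open>real^'k\<close>, is the nonnegative orthant.  Stages are numbered from 1; the data
  \<open>p\<close>, \<open>s\<close> of the basic table only matter on \<open>{1..I}\<close>.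
\<close>

definition periodic_ext :: "nat \<Rightarrow> (nat \<Rightarrow> 'a) \<Rightarrow> nat \<Rightarrow> 'a" where
  "periodic_ext I f i = f ((i - 1) mod I + 1)"

definition cyclic_table :: "nat \<Rightarrow> (nat \<Rightarrow> 'k) \<Rightarrow> bool" where
  "cyclic_table I p \<longleftrightarrow> (\<forall>k. \<exists>!i. i \<in> {1..I} \<and> p i = k)"

definition total_load :: "('k::finite \<Rightarrow> real) \<Rightarrow> ('k \<Rightarrow> real) \<Rightarrow> real" where
  "total_load lam mu = (\<Sum>k\<in>UNIV. lam k / mu k)"

definition cycle_length ::
  "nat \<Rightarrow> ('k::finite \<Rightarrow> real) \<Rightarrow> ('k \<Rightarrow> real) \<Rightarrow> (nat \<Rightarrow> real) \<Rightarrow> nat \<Rightarrow> real" where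
  "cycle_length I lam mu s L = (\<Sum>i=1..I. s i) * real L / (1 - total_load lam mu)"

text \<open>The epoch at which stage \<open>i\<close> is polled, for busy times \<open>b\<close>; stage 1 is polled at time 0.\<close>

definition poll_time :: "nat \<Rightarrow> (nat \<Rightarrow> real) \<Rightarrow> (nat \<Rightarrow> real) \<Rightarrow> nat \<Rightarrow> real" where
  "poll_time I s b i = (\<Sum>j\<in>{1..<i}. b j + periodic_ext I s j)"

text \<open>
  \<open>q\<close> is an \<open>L\<close>-cycle PE-candidate with busy times \<open>b\<close>.  Only the restriction of \<open>q\<close> to
  \<open>[0, \<tau>\<^sub>L]\<close> is constrained.  Busy and switchover periods may have length zero, so
  derivatives are prescribed in the interior of each period and the pieces are joined by
  continuity.
\<close>

definition PE_candidate_with ::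
  "nat \<Rightarrow> (nat \<Rightarrow> 'k) \<Rightarrow> ('k::finite \<Rightarrow> real) \<Rightarrow> ('k \<Rightarrow> real) \<Rightarrow> (nat \<Rightarrow> real)
    \<Rightarrow> nat \<Rightarrow> (nat \<Rightarrow> real) \<Rightarrow> (real \<Rightarrow> real^'k) \<Rightarrow> bool" where
  "PE_candidate_with I p lam mu s L b q \<longleftrightarrow>
     (let \<tau> = cycle_length I lam mu s L; T = poll_time I s b in
        continuous_on {0..\<tau>} q \<and>
        q ` {0..\<tau>} \<subseteq> {0..} \<and>
        q 0 = q \<tau> \<and>
        (\<forall>i\<in>{1..I * L}. 0 \<le> b i) \<and>
        T (I * L + 1) = \<tau> \<and>
        (\<forall>i\<in>{1..I * L}.
           (\<forall>u\<in>{T i <..< T i + b i}. \<forall>k.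
              ((\<lambda>t. q t $ k) has_real_derivative
                 (if k = periodic_ext I p i then lam k - mu k else lam k)) (at u)) \<and>
           (\<forall>u\<in>{T i + b i <..< T (i + 1)}. \<forall>k.
              ((\<lambda>t. q t $ k) has_real_derivative lam k) (at u))))"

text \<open>
  A candidate is recorded together with its cycle length, since a function on all of
  \<open>real\<close> does not determine the interval \<open>[0, \<tau>\<^sub>L]\<close> on which the curve lives.
\<close>

definition PE_candidates ::
  "nat \<Rightarrow> (nat \<Rightarrow> 'k) \<Rightarrow> ('k::finite \<Rightarrow> real) \<Rightarrow> ('k \<Rightarrow> real) \<Rightarrow> (nat \<Rightarrow> real)
    \<Rightarrow> (real \<times> (real \<Rightarrow> real^'k)) set" where
  "PE_candidates I p lam mu s =
     {(\<tau>, q). \<exists>L\<ge>1. \<tau> = cycle_length I lam mu s L \<and>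
        (\<exists>b. PE_candidate_with I p lam mu s L b q)}"

text \<open>Exhaustive service: the attended queue is empty when the server leaves it.\<close>

definition exhaustive_PE_candidate ::
  "nat \<Rightarrow> (nat \<Rightarrow> 'k) \<Rightarrow> ('k::finite \<Rightarrow> real) \<Rightarrow> ('k \<Rightarrow> real) \<Rightarrow> (nat \<Rightarrow> real)
    \<Rightarrow> (real \<Rightarrow> real^'k) \<Rightarrow> bool" where
  "exhaustive_PE_candidate I p lam mu s q \<longleftrightarrow>
     (\<exists>b. PE_candidate_with I p lam mu s 1 b q \<and>
        (\<forall>i\<in>{1..I}. q (poll_time I s b i + b i) $ p i = 0))"

definition average_cost :: "(real^'k \<Rightarrow> real) \<Rightarrow> real \<times> (real \<Rightarrow> real^'k) \<Rightarrow> real" where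
  "average_cost \<psi> e = (case e of (\<tau>, q) \<Rightarrow> 1 / \<tau> * integral {0..\<tau>} (\<lambda>u. \<psi> (q u)))"

definition separable_convex :: "(real^'k \<Rightarrow> real) \<Rightarrow> bool" where
  "separable_convex \<psi> \<longleftrightarrow>
     (\<exists>\<psi>k :: 'k \<Rightarrow> real \<Rightarrow> real.
        (\<forall>k. convex_on {0..} (\<psi>k k) \<and> \<psi>k k ` {0..} \<subseteq> {0..}) \<and>
        (\<forall>x\<in>{0..}. \<psi> x = (\<Sum>k\<in>UNIV. \<psi>k k (x $ k))))"

end

theory Submission
  imports Defs
begin

text \<open>
  By separability it suffices to treat each queue \<open>k\<close> on its own. Write \<open>g = \<psi>\<^sub>k\<close> and
  \<open>G(y) = \<integral>\<^sub>0\<^sup>y g\<close>. Along a candidate, \<open>g \<circ> q\<^sub>k\<close> is the derivative of \<open>G \<circ> q\<^sub>k\<close> divided by the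
  current slope of \<open>q\<^sub>k\<close>; by periodicity the increments of \<open>G \<circ> q\<^sub>k\<close> add up to zero, so
  \<open>\<integral> g(q\<^sub>k)\<close> equals \<open>\<mu>\<^sub>k / (\<lambda>\<^sub>k (\<mu>\<^sub>k - \<lambda>\<^sub>k))\<close> times the total decrease of \<open>G \<circ> q\<^sub>k\<close> during the
  \<open>L\<close> visits to the queue. A visit of length \<open>b\<close> decreases \<open>G \<circ> q\<^sub>k\<close> by at least
  \<open>G((\<mu>\<^sub>k - \<lambda>\<^sub>k) b)\<close>, with equality if it ends with an empty queue. The total busy time is
  determined by periodicity, and \<open>G\<close> is convex because \<open>g\<close> is nondecreasing, so Jensen's
  inequality shows that \<open>L\<close> equally long exhaustive visits are optimal.
\<close>

section \<open>Primitives of nondecreasing functions\<close>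

definition primitive :: "(real \<Rightarrow> real) \<Rightarrow> real \<Rightarrow> real" where
  "primitive g y = integral {0..y} g"

lemma primitive_0 [simp]: "primitive g 0 = 0"
  by (simp add: primitive_def)

lemma primitive_diff:
  assumes "continuous_on {0..} g" "0 \<le> a" "a \<le> b"
  shows "primitive g b - primitive g a = integral {a..b} g"
proof -
  have "g integrable_on {0..b}"
    using assms by (intro integrable_continuous_real) (auto intro: continuous_on_subset)
  then have "integral {0..a} g + integral {a..b} g = integral {0..b} g"
    using assms by (intro Henstock_Kurzweil_Integration.integral_combine) auto
  then show ?thesis
    by (simp add: primitive_def)
qed

text \<open>Convexity in supporting-line form: \<open>g\<close> stays above \<open>g x\<close> to
  the right of \<open>x\<close> and below it to the left. Applied at a common base point
  \<open>x\<close>, this gives Jensen's inequality for sums.\<close>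

lemma primitive_tangent:
  assumes "continuous_on {0..} g" "mono_on {0..} g" "0 \<le> x" "0 \<le> y"
  shows "primitive g y \<ge> primitive g x + g x * (y - x)"
proof -
  have int: "g integrable_on {a..b}" if "0 \<le> a" for a b
    using assms that by (intro integrable_continuous_real) (auto intro: continuous_on_subset)
  show ?thesis
  proof (cases "x \<le> y")
    case True
    have "integral {x..y} (\<lambda>_. g x) \<le> integral {x..y} g"
      using assms True int by (intro integral_le) (auto intro: mono_onD[OF assms(2)])
    then show ?thesis
      using primitive_diff[of g x y] assms True by (simp add: mult.commute)
  next
    case False
    then have "integral {y..x} g \<le> integral {y..x} (\<lambda>_. g x)"
      using assms int by (intro integral_le) (auto intro: mono_onD[OF assms(2)])
    then show ?thesis
      using primitive_diff[of g y x] assms False by (simp add: algebra_simps)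
  qed
qed

text \<open>Shifting the window \<open>{y..y + h}\<close> back to \<open>{0..h}\<close> can only
  lower a nondecreasing integrand. With \<open>y\<close> the queue left behind by a visit, this
  shows why leaving work behind cannot pay.\<close>

lemma primitive_superadditive:
  assumes "continuous_on {0..} g" "mono_on {0..} g" "0 \<le> y" "0 \<le> h"
  shows "primitive g (y + h) - primitive g y \<ge> primitive g h"
proof -
  have int: "g integrable_on {a..b}" if "0 \<le> a" for a b
    using assms that by (intro integrable_continuous_real) (auto intro: continuous_on_subset)
  have shift: "integral {y..y + h} g = integral {0..h} (\<lambda>v. g (v + y))"
    using integral_shift_Icc_real[of 0 h g y] by (simp add: o_def add.commute)
  have "integral {0..h} g \<le> integral {0..h} (\<lambda>v. g (v + y))"
  proof (rule integral_le)
    show "(\<lambda>v. g (v + y)) integrable_on {0..h}"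
      using assms by (intro integrable_continuous_real continuous_on_compose2[OF assms(1)])
        (auto intro!: continuous_intros)
  qed (use assms int in \<open>auto intro: mono_onD[OF assms(2)]\<close>)
  then show ?thesis
    using primitive_diff[of g y "y + h"] shift assms by (simp add: primitive_def)
qed

text \<open>The chain rule makes \<open>c * g (f u)\<close> the derivative of
  \<open>primitive g\<close> along \<open>f\<close>. The slope stands as a factor so that no
  division by \<open>c\<close> occurs, and derivatives are asked only in the interior, as for
  candidates.\<close>

lemma primitive_along_segment:
  fixes f :: "real \<Rightarrow> real"
  assumes g: "continuous_on {0..} g" and "a \<le> b"
    and f: "continuous_on {a..b} f" "\<And>u. u \<in> {a..b} \<Longrightarrow> 0 \<le> f u"
    and df: "\<And>u. u \<in> {a<..<b} \<Longrightarrow> (f has_real_derivative c) (at u)"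
  shows "c * integral {a..b} (\<lambda>u. g (f u)) = primitive g (f b) - primitive g (f a)"
proof -
  \<comment> \<open>The derivative of an integral function is available on a compact interval, so
    the range of \<open>f\<close> is first enclosed in one.\<close>
  obtain M where M: "f ` {a..b} \<subseteq> {0..M}"
  proof -
    have "bounded (f ` {a..b})"
      using f by (intro compact_imp_bounded compact_continuous_image) auto
    then obtain M where "\<And>x. x \<in> f ` {a..b} \<Longrightarrow> norm x \<le> M"
      by (auto simp: bounded_iff)
    then show ?thesis
      using f(2) by (intro that[of M]) fastforce
  qed
  have gM: "continuous_on {0..M} g"
    using g by (rule continuous_on_subset) auto
  have dG: "(primitive g has_real_derivative g y) (at y within {0..M})" if "y \<in> {0..M}" for y
    unfolding primitive_def using integral_has_real_derivative[OF gM that] .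
  have cG: "continuous_on {0..M} (primitive g)"
    by (rule DERIV_continuous_on[OF dG])
  have "((\<lambda>u. c * g (f u)) has_integral (primitive g (f b) - primitive g (f a))) {a..b}"
  proof (rule fundamental_theorem_of_calculus_interior)
    show "continuous_on {a..b} (\<lambda>u. primitive g (f u))"
      using cG f(1) M by (rule continuous_on_compose2)
  next
    fix u assume u: "u \<in> {a<..<b}"
    \<comment> \<open>The derivative of \<open>primitive g\<close> is known only within
      \<open>{0..M}\<close>, so the chain rule is applied relative to the image of \<open>f\<close>;
      the restriction on \<open>u\<close> then disappears because \<open>u\<close> is
      interior.\<close>
    have "(primitive g has_real_derivative g (f u)) (at (f u) within f ` {a..b})"
    proof (rule DERIV_subset[OF dG M])
      show "f u \<in> {0..M}"
        using M u by (auto simp: image_subset_iff)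
    qed
    moreover have "(f has_real_derivative c) (at u within {a..b})"
      using df[OF u] by (rule has_field_derivative_at_within)
    ultimately have "(primitive g \<circ> f has_real_derivative g (f u) * c) (at u within {a..b})"
      by (rule DERIV_image_chain)
    moreover have "at u within {a..b} = at u"
      using u by (intro at_within_interior) auto
    ultimately show "((\<lambda>u. primitive g (f u)) has_vector_derivative c * g (f u)) (at u)"
      by (simp add: has_real_derivative_iff_has_vector_derivative o_def mult.commute)
  qed fact
  then have "integral {a..b} (\<lambda>u. c * g (f u)) = primitive g (f b) - primitive g (f a)"
    by (rule integral_unique)
  then show ?thesis
    by simp
qed

section \<open>Increments and integrals over consecutive intervals\<close>

lemma constant_slope_increment:
  fixes f :: "real \<Rightarrow> real"
  assumes "a \<le> b" "continuous_on {a..b} f"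
    and "\<And>u. u \<in> {a<..<b} \<Longrightarrow> (f has_real_derivative c) (at u)"
  shows "f b - f a = c * (b - a)"
proof -
  have "((\<lambda>_. c) has_integral (f b - f a)) {a..b}"
    using assms by (intro fundamental_theorem_of_calculus_interior)
      (auto simp: has_real_derivative_iff_has_vector_derivative)
  moreover have "((\<lambda>_. c) has_integral (c * (b - a))) {a..b}"
    using has_integral_const_real[of c a b] assms(1) by (simp add: mult.commute)
  ultimately show ?thesis
    by (rule has_integral_unique)
qed

text \<open>The order of the endpoints is part of the conclusion because the induction step needs it
  to append the next interval.\<close>

lemma integral_combine_sequence:
  fixes f :: "real \<Rightarrow> real" and T :: "nat \<Rightarrow> real"
  assumes "\<And>i. i \<in> {1..n} \<Longrightarrow> T i \<le> T (Suc i)" "f integrable_on {T 1..T (Suc n)}"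
  shows "T 1 \<le> T (Suc n) \<and>
    integral {T 1..T (Suc n)} f = (\<Sum>i=1..n. integral {T i..T (Suc i)} f)"
  using assms
proof (induction n)
  case (Suc n)
  have le: "T (Suc n) \<le> T (Suc (Suc n))"
    using Suc.prems(1)[of "Suc n"] by simp
  have "f integrable_on {T 1..T (Suc n)}"
    using Suc.prems(2) by (rule integrable_on_subinterval) (use le in auto)
  then have IH: "T 1 \<le> T (Suc n)"
    "integral {T 1..T (Suc n)} f = (\<Sum>i=1..n. integral {T i..T (Suc i)} f)"
    using Suc by auto
  have "integral {T 1..T (Suc n)} f + integral {T (Suc n)..T (Suc (Suc n))} f
      = integral {T 1..T (Suc (Suc n))} f"
    using IH(1) le Suc.prems(2) by (intro Henstock_Kurzweil_Integration.integral_combine) auto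
  then show ?case
    using IH le by simp
qed simp

section \<open>A single queue\<close>

text \<open>
  \<open>T i\<close> is the start of stage \<open>i\<close>, \<open>D i\<close> the end of its busy period, and \<open>V\<close> the set of stages
  at which the queue under consideration is served.
\<close>

locale sawtooth =
  fixes f :: "real \<Rightarrow> real" and T D :: "nat \<Rightarrow> real" and n :: nat and V :: "nat set"
    and lam mu :: real
  assumes rates: "0 < lam" "lam < mu"
    and V: "V \<subseteq> {1..n}"
    and T_le_D: "\<And>i. i \<in> {1..n} \<Longrightarrow> T i \<le> D i"
    and D_le_T: "\<And>i. i \<in> {1..n} \<Longrightarrow> D i \<le> T (Suc i)"
    and cont: "continuous_on {T 1..T (Suc n)} f"
    and nonneg: "\<And>u. u \<in> {T 1..T (Suc n)} \<Longrightarrow> 0 \<le> f u"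
    and closed: "f (T 1) = f (T (Suc n))"
    and busy: "\<And>i u. i \<in> {1..n} \<Longrightarrow> u \<in> {T i<..<D i} \<Longrightarrow>
      (f has_real_derivative (if i \<in> V then lam - mu else lam)) (at u)"
    and switching: "\<And>i u. i \<in> {1..n} \<Longrightarrow> u \<in> {D i<..<T (Suc i)} \<Longrightarrow>
      (f has_real_derivative lam) (at u)"
begin

lemma T_step: "i \<in> {1..n} \<Longrightarrow> T i \<le> T (Suc i)"
  using T_le_D D_le_T by force

lemma T_mono: "1 \<le> i \<Longrightarrow> i \<le> j \<Longrightarrow> j \<le> Suc n \<Longrightarrow> T i \<le> T j"
proof (induction j)
  case (Suc j)
  show ?case
  proof (cases "i = Suc j")
    case False
    then have "T i \<le> T j"
      using Suc by simp
    also have "\<dots> \<le> T (Suc j)"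
      using Suc.prems False by (intro T_step) simp
    finally show ?thesis .
  qed simp
qed simp

lemma stage_bounds:
  assumes "i \<in> {1..n}"
  shows "T 1 \<le> T i" "T i \<le> D i" "D i \<le> T (Suc i)" "T (Suc i) \<le> T (Suc n)"
  using assms T_mono[of 1 i] T_mono[of "Suc i" "Suc n"] T_le_D D_le_T by auto

lemma sum_telescope: "(\<Sum>i=1..n. (h (T (Suc i)) :: real) - h (T i)) = h (T (Suc n)) - h (T 1)"
  using sum_Suc_diff[of 1 n "\<lambda>i. h (T i)"] by simp

lemma sum_visits: "(\<Sum>i=1..n. if i \<in> V then (h i :: real) else 0) = sum h V"
  using V by (simp add: sum.If_cases Int_absorb1)

lemma busy_increment:
  assumes "i \<in> {1..n}"
  shows "f (D i) - f (T i) = (if i \<in> V then lam - mu else lam) * (D i - T i)"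
  using stage_bounds[OF assms] busy[OF assms]
  by (intro constant_slope_increment continuous_on_subset[OF cont]) auto

lemma switching_increment:
  assumes "i \<in> {1..n}"
  shows "f (T (Suc i)) - f (D i) = lam * (T (Suc i) - D i)"
  using stage_bounds[OF assms] switching[OF assms]
  by (intro constant_slope_increment continuous_on_subset[OF cont]) auto

text \<open>Work balance: on a closed curve the inflow at rate \<open>lam\<close> over the whole
  period equals the outflow at rate \<open>mu\<close> during visits. The total visit length is
  therefore fixed, which is the constraint in the Jensen step.\<close>

lemma total_busy_time: "mu * (\<Sum>i\<in>V. D i - T i) = lam * (T (Suc n) - T 1)"
proof -
  have "f (T (Suc i)) - f (T i) =
      lam * (T (Suc i) - T i) - (if i \<in> V then mu * (D i - T i) else 0)" if "i \<in> {1..n}" for i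
    using busy_increment[OF that] switching_increment[OF that]
    by (auto simp: algebra_simps split: if_splits)
  then have "(\<Sum>i=1..n. f (T (Suc i)) - f (T i)) =
      (\<Sum>i=1..n. lam * (T (Suc i) - T i) - (if i \<in> V then mu * (D i - T i) else 0))"
    by (intro sum.cong) auto
  also have "\<dots> = lam * (\<Sum>i=1..n. T (Suc i) - T i)
      - (\<Sum>i=1..n. if i \<in> V then mu * (D i - T i) else 0)"
    unfolding sum_subtractf[of "\<lambda>i. lam * (T (Suc i) - T i)"] sum_distrib_left ..
  finally show ?thesis
    unfolding sum_telescope[of f] sum_telescope[of "\<lambda>x. x"] sum_visits
    using closed by (simp add: sum_distrib_left)
qed

lemma cost_integral:
  assumes g: "continuous_on {0..} g"
  shows "integral {T 1..T (Suc n)} (\<lambda>u. g (f u)) =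
    mu / (lam * (mu - lam)) * (\<Sum>i\<in>V. primitive g (f (T i)) - primitive g (f (D i)))"
proof -
  let ?J = "\<lambda>a b. integral {a..b} (\<lambda>u. g (f u))" and ?G = "\<lambda>u. primitive g (f u)"
  have int: "(\<lambda>u. g (f u)) integrable_on {T 1..T (Suc n)}"
    using g cont nonneg by (intro integrable_continuous_real continuous_on_compose2[OF g]) auto
  \<comment> \<open>During a visit the integral is the drop of \<open>?G\<close> divided by
    \<open>mu - lam\<close>, and the subsequent rise is the net increment of the stage plus that
    drop. The coefficient is thus \<open>1 + lam / (mu - lam) = mu / (mu - lam)\<close>.\<close>
  have stage: "lam * ?J (T i) (T (Suc i)) = ?G (T (Suc i)) - ?G (T i) +
      (if i \<in> V then mu / (mu - lam) * (?G (T i) - ?G (D i)) else 0)" if i: "i \<in> {1..n}" for i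
  proof -
    note b = stage_bounds[OF i]
    have 1: "(if i \<in> V then lam - mu else lam) * ?J (T i) (D i) = ?G (D i) - ?G (T i)"
      using b busy[OF i] nonneg
      by (intro primitive_along_segment g continuous_on_subset[OF cont]) auto
    have 2: "lam * ?J (D i) (T (Suc i)) = ?G (T (Suc i)) - ?G (D i)"
      using b switching[OF i] nonneg
      by (intro primitive_along_segment g continuous_on_subset[OF cont]) auto
    have 3: "?J (T i) (D i) + ?J (D i) (T (Suc i)) = ?J (T i) (T (Suc i))"
      using b by (intro Henstock_Kurzweil_Integration.integral_combine
          integrable_on_subinterval[OF int]) auto
    show ?thesis
    proof (cases "i \<in> V")
      case True
      with 1 have drop: "?G (T i) - ?G (D i) = (mu - lam) * ?J (T i) (D i)"
        by (simp add: left_diff_distrib)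
      have "mu / (mu - lam) * (?G (T i) - ?G (D i)) = mu * ?J (T i) (D i)"
        unfolding drop using rates by simp
      with True 2 drop show ?thesis
        unfolding 3[symmetric] by (simp add: distrib_left left_diff_distrib)
    next
      case False
      with 1 2 show ?thesis
        unfolding 3[symmetric] by (simp add: distrib_left)
    qed
  qed
  have "lam * ?J (T 1) (T (Suc n)) = (\<Sum>i=1..n. lam * ?J (T i) (T (Suc i)))"
    using integral_combine_sequence[OF T_step int] by (simp add: sum_distrib_left)
  also have "\<dots> = (\<Sum>i=1..n. ?G (T (Suc i)) - ?G (T i)) +
      (\<Sum>i=1..n. if i \<in> V then mu / (mu - lam) * (?G (T i) - ?G (D i)) else 0)"
    unfolding sum.distrib[symmetric] using stage by (intro sum.cong) auto
  also have "\<dots> = mu / (mu - lam) * (\<Sum>i\<in>V. ?G (T i) - ?G (D i))"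
    unfolding sum_visits sum_telescope[of ?G] using closed by (simp add: sum_distrib_left)
  finally show ?thesis
    using rates by (simp add: field_simps)
qed

lemma visit_start_value:
  assumes "i \<in> V"
  shows "f (T i) = f (D i) + (mu - lam) * (D i - T i)"
proof -
  have "i \<in> {1..n}"
    using assms V by auto
  from busy_increment[OF this] show ?thesis
    using assms by (simp add: algebra_simps)
qed

text \<open>With a single visit, work balance fixes its length; since it ends at 0, its length fixes
  the value at its start, and the drop of the primitive is this starting value's primitive.\<close>

lemma cost_integral_exhaustive:
  assumes "continuous_on {0..} g" "V = {j}" "f (D j) = 0"
  shows "integral {T 1..T (Suc n)} (\<lambda>u. g (f u)) =
    mu / (lam * (mu - lam)) * primitive g ((mu - lam) * (lam / mu * (T (Suc n) - T 1)))"
proof -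
  have "D j - T j = lam / mu * (T (Suc n) - T 1)"
    using total_busy_time assms rates by (simp add: field_simps)
  then have "f (T j) = (mu - lam) * (lam / mu * (T (Suc n) - T 1))"
    using visit_start_value[of j] assms by simp
  then show ?thesis
    using cost_integral[OF assms(1)] assms by simp
qed

lemma cost_integral_lower_bound:
  assumes g: "continuous_on {0..} g" "mono_on {0..} g"
    and L: "card V = L" and \<tau>: "T (Suc n) - T 1 = \<tau> * L" "0 \<le> \<tau>"
  shows "integral {T 1..T (Suc n)} (\<lambda>u. g (f u)) \<ge>
    L * (mu / (lam * (mu - lam)) * primitive g ((mu - lam) * (lam / mu * \<tau>)))"
proof -
  \<comment> \<open>The queue length at which the only visit of an exhaustive cycle of length
    \<open>\<tau>\<close> begins.\<close>
  define h where "h = (mu - lam) * (lam / mu * \<tau>)"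
  have h: "0 \<le> h"
    using rates \<tau> by (simp add: h_def)
  \<comment> \<open>Jensen's inequality via the supporting line at \<open>h\<close>: by work balance
    the values \<open>(mu - lam) * (D i - T i)\<close> sum to \<open>L * h\<close>, so the linear
    terms cancel.\<close>
  have "L * primitive g h = (\<Sum>i\<in>V. primitive g h + g h * ((mu - lam) * (D i - T i) - h))"
  proof -
    have "mu * (\<Sum>i\<in>V. D i - T i) = lam * (\<tau> * L)"
      using total_busy_time \<tau> by simp
    then have "(\<Sum>i\<in>V. D i - T i) = lam / mu * (\<tau> * L)"
      using rates by (simp add: field_simps)
    then have "(\<Sum>i\<in>V. (mu - lam) * (D i - T i) - h) = 0"
      using L by (simp add: sum_subtractf sum_distrib_left[symmetric] h_def)
    then show ?thesis
      using L by (simp add: sum.distrib sum_distrib_left[symmetric])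
  qed
  also have "\<dots> \<le> (\<Sum>i\<in>V. primitive g (f (T i)) - primitive g (f (D i)))"
  proof (rule sum_mono)
    fix i assume i: "i \<in> V"
    then have "i \<in> {1..n}"
      using V by auto
    note b = stage_bounds[OF this]
    have len: "0 \<le> (mu - lam) * (D i - T i)"
      using b rates by simp
    have "primitive g h + g h * ((mu - lam) * (D i - T i) - h)
        \<le> primitive g ((mu - lam) * (D i - T i))"
      by (rule primitive_tangent[OF g h len])
    also have "\<dots> \<le> primitive g (f (T i)) - primitive g (f (D i))"
      unfolding visit_start_value[OF i]
      using b nonneg by (intro primitive_superadditive g len) auto
    finally show "primitive g h + g h * ((mu - lam) * (D i - T i) - h) \<le> \<dots>" .
  qed
  finally have "mu / (lam * (mu - lam)) * (L * primitive g h) \<le>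
      mu / (lam * (mu - lam)) * (\<Sum>i\<in>V. primitive g (f (T i)) - primitive g (f (D i)))"
    using rates by (intro mult_left_mono) auto
  then show ?thesis
    using cost_integral[OF g(1)] by (simp add: h_def mult.left_commute)
qed

end

section \<open>Polling tables\<close>

lemma periodic_ext_eq [simp]: "i \<in> {1..I} \<Longrightarrow> periodic_ext I f i = f i"
  by (cases i) (auto simp: periodic_ext_def)

text \<open>Transfers properties of the data on \<open>{1..I}\<close> to every index of the
  extension, including 0, where truncated subtraction gives the value at 1.\<close>

lemma periodic_ext_index: "0 < I \<Longrightarrow> \<exists>j\<in>{1..I}. periodic_ext I f i = f j"
  by (auto simp: periodic_ext_def Suc_le_eq)

text \<open>Splitting off the last block of \<open>I\<close> stages and shifting it back to
  \<open>{1..I}\<close> gives the induction step. The function \<open>h\<close> is there so that an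
  indicator can be used to count visits.\<close>

lemma sum_periodic_ext:
  fixes h :: "'a \<Rightarrow> real"
  assumes "0 < I"
  shows "(\<Sum>i=1..I * L. h (periodic_ext I f i)) = L * (\<Sum>i=1..I. h (f i))"
proof (induction L)
  case (Suc L)
  have "(\<Sum>i=1..I * Suc L. h (periodic_ext I f i)) =
      (\<Sum>i=1..I * L. h (periodic_ext I f i)) + (\<Sum>i=I * L + 1..I * L + I. h (periodic_ext I f i))"
    using sum.ub_add_nat[of 1 "I * L" "\<lambda>i. h (periodic_ext I f i)" I] by (simp add: add.commute)
  also have "(\<Sum>i=I * L + 1..I * L + I. h (periodic_ext I f i)) =
      (\<Sum>i=1..I. h (periodic_ext I f (i + I * L)))"
    using sum.shift_bounds_cl_nat_ivl[of "\<lambda>i. h (periodic_ext I f i)" 1 "I * L" I]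
    by (simp add: add.commute)
  also have "\<dots> = (\<Sum>i=1..I. h (f i))"
  proof (rule sum.cong)
    fix i assume "i \<in> {1..I}"
    then obtain j where "i = Suc j" "j < I"
      by (cases i) auto
    then show "h (periodic_ext I f (i + I * L)) = h (f i)"
      by (simp add: periodic_ext_def)
  qed simp
  finally show ?case
    using Suc.IH by (simp add: algebra_simps)
qed simp

lemma cyclic_table_bij_betw: "cyclic_table I p \<Longrightarrow> bij_betw p {1..I} UNIV"
  unfolding cyclic_table_def bij_betw_def inj_on_def by (metis surj_def UNIV_eq_I imageI)

lemma card_visits:
  assumes "cyclic_table I p" "0 < I"
  shows "card {i\<in>{1..I * L}. periodic_ext I p i = k} = L"
proof -
  let ?h = "\<lambda>j. if j = k then 1 else (0::real)"
  have "real (card {i\<in>{1..I * L}. periodic_ext I p i = k}) =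
      (\<Sum>i=1..I * L. ?h (periodic_ext I p i))"
    by (simp add: sum.If_cases Int_def)
  also have "\<dots> = L * (\<Sum>i=1..I. ?h (p i))"
    by (rule sum_periodic_ext[OF assms(2)])
  also have "(\<Sum>i=1..I. ?h (p i)) = 1"
  proof -
    obtain j where "j \<in> {1..I}" "p j = k" "\<And>i. i \<in> {1..I} \<Longrightarrow> p i = k \<longleftrightarrow> i = j"
      using assms(1) unfolding cyclic_table_def by metis
    then have "(\<Sum>i=1..I. ?h (p i)) = (\<Sum>i=1..I. if i = j then 1 else 0)"
      by (intro sum.cong) auto
    then show ?thesis
      using \<open>j \<in> {1..I}\<close> by simp
  qed
  finally show ?thesis
    by simp
qed

section \<open>Load condition, polling epochs and the coordinates of a candidate\<close>

lemma lam_less_mu: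
  assumes "\<And>k::'k::finite. 0 < lam k" "\<And>k. 0 < mu k" "total_load lam mu < 1"
  shows "lam k < mu k"
proof -
  have "lam k / mu k \<le> total_load lam mu"
    unfolding total_load_def using assms(1,2) by (intro member_le_sum) (auto intro: less_imp_le)
  then have "lam k / mu k < 1"
    using assms(3) by simp
  then show ?thesis
    using assms(2)[of k] by simp
qed

lemma poll_time_1 [simp]: "poll_time I s b 1 = 0" "poll_time I s b (Suc 0) = 0"
  by (simp_all add: poll_time_def)

lemma poll_time_Suc:
  "1 \<le> i \<Longrightarrow> poll_time I s b (Suc i) = poll_time I s b i + b i + periodic_ext I s i"
  by (simp add: poll_time_def)

text \<open>Reduces the vector curve to one coordinate: the other queues enter only through stages
  outside the visit set, during which coordinate \<open>k\<close> rises at rate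
  \<open>lam k\<close>.\<close>

lemma PE_candidate_sawtooth:
  assumes q: "PE_candidate_with I p lam mu s L b q"
    and rates: "0 < lam k" "lam k < mu k" and "0 < I"
    and s: "\<And>i. i \<in> {1..I} \<Longrightarrow> 0 \<le> s i"
  shows "sawtooth (\<lambda>u. q u $ k) (poll_time I s b) (\<lambda>i. poll_time I s b i + b i) (I * L)
    {i\<in>{1..I * L}. periodic_ext I p i = k} (lam k) (mu k)"
proof -
  define \<tau> where "\<tau> = cycle_length I lam mu s L"
  define T where "T = poll_time I s b"
  have q_cont: "continuous_on {0..\<tau>} q" and q_range: "q ` {0..\<tau>} \<subseteq> {0..}"
    and q_closed: "q 0 = q \<tau>" and b: "\<And>i. i \<in> {1..I * L} \<Longrightarrow> 0 \<le> b i"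
    and end_time: "T (Suc (I * L)) = \<tau>"
    and q_busy: "\<And>i u. i \<in> {1..I * L} \<Longrightarrow> u \<in> {T i<..<T i + b i} \<Longrightarrow>
      ((\<lambda>t. q t $ k) has_real_derivative
        (if k = periodic_ext I p i then lam k - mu k else lam k)) (at u)"
    and q_switching: "\<And>i u. i \<in> {1..I * L} \<Longrightarrow> u \<in> {T i + b i<..<T (Suc i)} \<Longrightarrow>
      ((\<lambda>t. q t $ k) has_real_derivative lam k) (at u)"
    using q unfolding PE_candidate_with_def Let_def \<tau>_def[symmetric] T_def[symmetric]
      Suc_eq_plus1 by blast+
  have start_time: "T 1 = 0"
    by (simp add: T_def)
  have s_ext: "0 \<le> periodic_ext I s i" for i
    using periodic_ext_index[OF \<open>0 < I\<close>, of s i] s by force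
  show ?thesis
    unfolding T_def[symmetric]
  proof unfold_locales
    show "continuous_on {T 1..T (Suc (I * L))} (\<lambda>u. q u $ k)"
      unfolding start_time end_time by (intro continuous_on_component q_cont)
    show "0 \<le> q u $ k" if "u \<in> {T 1..T (Suc (I * L))}" for u
    proof -
      have "q u \<in> {0..}"
        using q_range that unfolding start_time end_time by blast
      then show ?thesis
        by (simp add: less_eq_vec_def)
    qed
    show "q (T 1) $ k = q (T (Suc (I * L))) $ k"
      unfolding start_time end_time q_closed ..
    show "T i \<le> T i + b i" if "i \<in> {1..I * L}" for i
      using b[OF that] by simp
    show "T i + b i \<le> T (Suc i)" if "i \<in> {1..I * L}" for i
      using that s_ext[of i] by (simp add: T_def poll_time_Suc)
    show "((\<lambda>u. q u $ k) has_real_derivative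
        (if i \<in> {i\<in>{1..I * L}. periodic_ext I p i = k} then lam k - mu k else lam k)) (at u)"
      if "i \<in> {1..I * L}" "u \<in> {T i<..<T i + b i}" for i u
      using q_busy[OF that] that(1) by (auto split: if_splits)
    show "((\<lambda>u. q u $ k) has_real_derivative lam k) (at u)"
      if "i \<in> {1..I * L}" "u \<in> {T i + b i<..<T (Suc i)}" for i u
      using that by (rule q_switching)
  qed (use rates in auto)
qed

section \<open>Existence of the exhaustive candidate\<close>

lemma exhaustive_PE_candidate_exists:
  fixes p :: "nat \<Rightarrow> 'k::finite"
  assumes rates: "\<And>k. 0 < lam k" "\<And>k. 0 < mu k" and load: "total_load lam mu < 1"
    and s: "\<And>i. i \<in> {1..I} \<Longrightarrow> 0 \<le> s i" and cyc: "cyclic_table I p"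
  shows "\<exists>q. exhaustive_PE_candidate I p lam mu s q"
proof -
  define \<tau> where "\<tau> = cycle_length I lam mu s 1"
  \<comment> \<open>The length forced by work balance when a queue is visited once per cycle of
    length \<open>\<tau>\<close>.\<close>
  define b where "b i = lam (p i) / mu (p i) * \<tau>" for i
  define T where "T = poll_time I s b"
  define st where "st k = (THE i. i \<in> {1..I} \<and> p i = k)" for k
  have st: "st k \<in> {1..I}" "p (st k) = k" for k
    using theI'[of "\<lambda>i. i \<in> {1..I} \<and> p i = k"] cyc
    unfolding st_def cyclic_table_def by blast+
  have st_unique: "i = st (p i)" if "i \<in> {1..I}" for i
    using that st[of "p i"] cyc unfolding cyclic_table_def by metis
  have \<tau>: "\<tau> * (1 - total_load lam mu) = (\<Sum>i=1..I. s i)" "0 \<le> \<tau>"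
    using load s by (auto simp: \<tau>_def cycle_length_def intro!: divide_nonneg_pos sum_nonneg)
  have b: "0 \<le> b i" for i
    using rates \<tau> by (simp add: b_def less_imp_le)
  have T_Suc: "T (Suc i) = T i + b i + s i" if "i \<in> {1..I}" for i
    using that by (simp add: T_def poll_time_Suc)
  have T_mono: "T i \<le> T j" if "1 \<le> i" "i \<le> j" "j \<le> Suc I" for i j
    using that(2,1,3)
  proof (induction j rule: dec_induct)
    case (step j)
    then show ?case
      using T_Suc[of j] s[of j] b[of j] by simp
  qed simp
  have T_1: "T 1 = 0"
    by (simp add: T_def)
  \<comment> \<open>The cycle closes because the busy times add up to
    \<open>total_load lam mu * \<tau>\<close> and the switchover times to the remaining
    \<open>(1 - total_load lam mu) * \<tau>\<close>.\<close>
  have T_end: "T (Suc I) = \<tau>"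
  proof -
    have "T (Suc I) = (\<Sum>i=1..I. b i + s i)"
      unfolding T_def poll_time_def by (intro sum.cong) auto
    also have "\<dots> = (\<Sum>i=1..I. lam (p i) / mu (p i)) * \<tau> + (\<Sum>i=1..I. s i)"
      by (simp add: sum.distrib b_def sum_distrib_right)
    also have "(\<Sum>i=1..I. lam (p i) / mu (p i)) = total_load lam mu"
      unfolding total_load_def
      by (rule sum.reindex_bij_betw[OF cyclic_table_bij_betw[OF cyc], of "\<lambda>k. lam k / mu k"])
    finally show ?thesis
      using \<tau>(1) by (simp add: algebra_simps)
  qed
  define D where "D i = T i + b i" for i
  have D: "0 \<le> T i" "T i \<le> D i" "D i \<le> T (Suc i)" "T (Suc i) \<le> \<tau>" if "i \<in> {1..I}" for i
    using that T_mono[of 1 i] T_mono[of "Suc i" "Suc I"] T_1 T_end T_Suc[of i] s[of i] b[of i]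
    by (auto simp: D_def)
  \<comment> \<open>The first term is the inflow since queue \<open>k\<close> was emptied in the
    preceding cycle, at time \<open>D (st k) - \<tau>\<close>. The clipped difference is the service
    time received so far in the current cycle; after the visit it is \<open>b (st k)\<close>, and
    \<open>mub\<close> cancels one full cycle of inflow.\<close>
  define q :: "real \<Rightarrow> real^'k" where "q t = (\<chi> k. lam k * (t + \<tau> - D (st k))
      - mu k * max 0 (min (t - T (st k)) (b (st k))))" for t
  have mub: "mu k * b (st k) = lam k * \<tau>" for k
    using rates(2)[of k] by (simp add: b_def st)
  have q_nonneg: "0 \<le> q t $ k" if t: "t \<in> {0..\<tau>}" for t k
  proof -
    note d = D[OF st(1)[of k]]
    consider "t \<le> T (st k)" | "T (st k) \<le> t" "t \<le> D (st k)" | "D (st k) \<le> t"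
      by linarith
    then show ?thesis
    proof cases
      case 1
      then show ?thesis
        using t d rates(1)[of k] b[of "st k"] by (simp add: q_def)
    next
      case 2
      then have "q t $ k = (mu k - lam k) * (D (st k) - t)"
        using mub[of k] by (simp add: q_def D_def algebra_simps)
      then show ?thesis
        using 2 lam_less_mu[OF rates load, of k] by simp
    next
      case 3
      then have "q t $ k = lam k * (t - D (st k))"
        using mub[of k] b[of "st k"] by (simp add: q_def D_def algebra_simps)
      then show ?thesis
        using 3 rates(1)[of k] by simp
    qed
  qed
  have deriv: "((\<lambda>t. q t $ k) has_real_derivative c) (at u)"
    if "u \<in> S" "open S" "\<And>t. t \<in> S \<Longrightarrow> q t $ k = c * t + d" for u S c d k
  proof (rule has_field_derivative_transform_within_open)
    show "((\<lambda>t. c * t + d) has_real_derivative c) (at u)"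
      by (auto intro!: derivative_eq_intros)
  qed (use that in auto)
  have before: "((\<lambda>t. q t $ k) has_real_derivative lam k) (at u)" if "u < T (st k)" for u k
    using that b[of "st k"]
    by (intro deriv[of u "{..<T (st k)}" k _ "lam k * (\<tau> - D (st k))"]) (auto simp: q_def algebra_simps)
  have after: "((\<lambda>t. q t $ k) has_real_derivative lam k) (at u)" if "D (st k) < u" for u k
    using that b[of "st k"] mub[of k]
    by (intro deriv[of u "{D (st k)<..}" k _ "- lam k * D (st k)"]) (auto simp: q_def D_def algebra_simps)
  have during: "((\<lambda>t. q t $ k) has_real_derivative lam k - mu k) (at u)"
    if "T (st k) < u" "u < D (st k)" for u k
    using that
    by (intro deriv[of u "{T (st k)<..<D (st k)}" k _ "lam k * (\<tau> - D (st k)) + mu k * T (st k)"])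
      (auto simp: q_def D_def algebra_simps)
  have "PE_candidate_with I p lam mu s 1 b q"
    unfolding PE_candidate_with_def Let_def \<tau>_def[symmetric] T_def[symmetric]
  proof (intro conjI ballI allI)
    show "continuous_on {0..\<tau>} q"
      unfolding q_def by (intro continuous_intros continuous_on_vec_lambda)
    show "q ` {0..\<tau>} \<subseteq> {0..}"
      using q_nonneg by (auto simp: less_eq_vec_def)
    show "q 0 = q \<tau>"
    proof (rule vec_eq_iff[THEN iffD2], intro allI)
      fix k
      show "q 0 $ k = q \<tau> $ k"
        using D[OF st(1)[of k]] b[of "st k"] mub[of k] by (simp add: q_def D_def algebra_simps)
    qed
    show "T (I * 1 + 1) = \<tau>"
      using T_end by simp
    show "0 \<le> b i" for i
      by (rule b)
  next
    fix i u k assume i: "i \<in> {1..I * 1}" and u: "u \<in> {T i<..<T i + b i}"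
    have i': "i \<in> {1..I}"
      using i by simp
    note d = D[OF i'] D[OF st(1)[of k]]
    \<comment> \<open>By \<open>st_unique\<close>, stage \<open>i\<close> serves \<open>k\<close>
      exactly if \<open>i = st k\<close>; otherwise the order of the two stages decides whether
      \<open>u\<close> lies before or after the whole visit to \<open>k\<close>.\<close>
    consider "i = st k" | "i < st k" | "st k < i"
      by linarith
    then show "((\<lambda>t. q t $ k) has_real_derivative
        (if k = periodic_ext I p i then lam k - mu k else lam k)) (at u)"
    proof cases
      case 1
      then show ?thesis
        using during[of k u] u i' st[of k] by (simp add: D_def)
    next
      case 2
      then have "u < T (st k)"
        using u d T_mono[of "Suc i" "st k"] st(1)[of k] by (auto simp: D_def)
      then show ?thesis
        using before[of u k] 2 i' st_unique[OF i'] by auto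
    next
      case 3
      then have "D (st k) < u"
        using u d T_mono[of "Suc (st k)" i] i' by auto
      then show ?thesis
        using after[of k u] 3 i' st_unique[OF i'] by auto
    qed
  next
    fix i u k assume i: "i \<in> {1..I * 1}" and u: "u \<in> {T i + b i<..<T (i + 1)}"
    have i': "i \<in> {1..I}"
      using i by simp
    note d = D[OF i'] D[OF st(1)[of k]]
    show "((\<lambda>t. q t $ k) has_real_derivative lam k) (at u)"
    proof (cases "i < st k")
      case True
      then have "u < T (st k)"
        using u d T_mono[of "Suc i" "st k"] st(1)[of k] by auto
      then show ?thesis
        by (rule before)
    next
      case False
      then have "D (st k) \<le> D i"
        using d T_mono[of "Suc (st k)" i] i' by (cases "i = st k") auto
      then show ?thesis
        using u by (intro after) (auto simp: D_def)
    qed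
  qed
  moreover have "q (poll_time I s b i + b i) $ p i = 0" if "i \<in> {1..I}" for i
    using st_unique[OF that] mub[of "p i"] b[of i]
    by (simp add: q_def D_def T_def[symmetric] algebra_simps)
  ultimately show ?thesis
    unfolding exhaustive_PE_candidate_def by blast
qed

section \<open>Separable costs\<close>

text \<open>On the \<open>k\<close>-th coordinate axis \<open>\<psi>\<close> differs from
  \<open>\<psi>k k\<close> by a constant, so the summand inherits both properties. Continuity at 0
  is obtained this way, since a convex function on \<open>{0..}\<close> may jump there.\<close>

lemma separable_summand_mono_continuous:
  fixes \<psi> :: "real^'k::finite \<Rightarrow> real"
  assumes sep: "\<And>x. x \<in> {0..} \<Longrightarrow> \<psi> x = (\<Sum>k\<in>UNIV. \<psi>k k (x $ k))"
    and "mono_on {0..} \<psi>" "continuous_on {0..} \<psi>"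
  shows "mono_on {0..} (\<psi>k k)" "continuous_on {0..} (\<psi>k k)"
proof -
  define c where "c = (\<Sum>j\<in>UNIV - {k}. \<psi>k j 0)"
  have ax: "axis k y \<in> {0..}" if "y \<in> {0..}" for y :: real
    using that by (auto simp: less_eq_vec_def axis_def)
  have eq: "\<psi>k k y = \<psi> (axis k y) - c" if "y \<in> {0..}" for y
  proof -
    have "\<psi> (axis k y) = \<psi>k k (axis k y $ k) + (\<Sum>j\<in>UNIV - {k}. \<psi>k j (axis k y $ j))"
      using sep[OF ax[OF that]] by (simp add: sum.remove[of _ k])
    also have "(\<Sum>j\<in>UNIV - {k}. \<psi>k j (axis k y $ j)) = c"
      unfolding c_def by (intro sum.cong) (auto simp: axis_def)
    finally show ?thesis
      by (simp add: axis_def)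
  qed
  show "mono_on {0..} (\<psi>k k)"
  proof (rule mono_onI)
    fix x y :: real assume xy: "x \<in> {0..}" "y \<in> {0..}" "x \<le> y"
    then have "axis k x \<le> axis k y"
      by (auto simp: less_eq_vec_def axis_def)
    then show "\<psi>k k x \<le> \<psi>k k y"
      using mono_onD[OF assms(2) ax ax] xy eq by auto
  qed
  have "continuous_on {0..} (\<lambda>y. \<psi> (axis k y) - c)"
  proof (intro continuous_on_diff continuous_on_const continuous_on_compose2[OF assms(3)])
    have "continuous_on {0..} (\<lambda>y::real. if i = k then y else 0)" for i
      by (cases "i = k") (auto intro: continuous_on_id continuous_on_const)
    then have "continuous_on {0..} (\<lambda>y::real. \<chi> i. if i = k then y else 0)"
      by (rule continuous_on_vec_lambda)
    then show "continuous_on {0..} (\<lambda>y::real. axis k y)"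
      by (simp add: axis_def)
  qed (use ax in auto)
  then show "continuous_on {0..} (\<psi>k k)"
    by (rule continuous_on_cong[THEN iffD1, rotated -1]) (auto simp: eq)
qed

lemma average_cost_separable:
  fixes q :: "real \<Rightarrow> real^'k::finite"
  assumes sep: "\<And>x. x \<in> {0..} \<Longrightarrow> \<psi> x = (\<Sum>k\<in>UNIV. \<psi>k k (x $ k))"
    and cont: "\<And>k. continuous_on {0..} (\<psi>k k)"
    and q: "continuous_on {0..\<tau>} q" "q ` {0..\<tau>} \<subseteq> {0..}"
  shows "average_cost \<psi> (\<tau>, q) = (\<Sum>k\<in>UNIV. integral {0..\<tau>} (\<lambda>u. \<psi>k k (q u $ k))) / \<tau>"
proof -
  have "integral {0..\<tau>} (\<lambda>u. \<psi> (q u)) = integral {0..\<tau>} (\<lambda>u. \<Sum>k\<in>UNIV. \<psi>k k (q u $ k))"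
    using q(2) sep by (intro integral_cong) blast
  also have "\<dots> = (\<Sum>k\<in>UNIV. integral {0..\<tau>} (\<lambda>u. \<psi>k k (q u $ k)))"
  proof (rule integral_sum)
    fix k
    have "(\<lambda>u. q u $ k) ` {0..\<tau>} \<subseteq> {0..}"
      using q(2) by (fastforce simp: less_eq_vec_def)
    then show "(\<lambda>u. \<psi>k k (q u $ k)) integrable_on {0..\<tau>}"
      using q(1) by (intro integrable_continuous_real continuous_on_compose2[OF cont])
        (auto intro!: continuous_intros)
  qed simp
  finally show ?thesis
    by (simp add: average_cost_def)
qed

theorem proposition4p1:
  fixes I :: nat
    and p :: "nat \<Rightarrow> 'k::finite"
    and lam mu :: "'k \<Rightarrow> real"
    and s :: "nat \<Rightarrow> real"
    and \<psi> :: "real^'k \<Rightarrow> real"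
  assumes "CARD('k) \<le> I"
    and "p ` {1..I} = UNIV"
    and "\<And>k. 0 < lam k"
    and "\<And>k. 0 < mu k"
    and "total_load lam mu < 1"
    and "\<And>i. i \<in> {1..I} \<Longrightarrow> 0 \<le> s i"
    and "0 < (\<Sum>i=1..I. s i)"
    and "\<psi> ` {0..} \<subseteq> {0..}"
    and "mono_on {0..} \<psi>"
    and "continuous_on {0..} \<psi>"
    and "cyclic_table I p"
    and "separable_convex \<psi>"
  shows "(\<exists>q_exh. exhaustive_PE_candidate I p lam mu s q_exh) \<and>
    (\<forall>q_exh. exhaustive_PE_candidate I p lam mu s q_exh \<longrightarrow>
       is_arg_min (average_cost \<psi>) (\<lambda>e. e \<in> PE_candidates I p lam mu s)
         (cycle_length I lam mu s 1, q_exh))"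
proof (intro conjI allI impI)
  show "\<exists>q_exh. exhaustive_PE_candidate I p lam mu s q_exh"
    using assms by (intro exhaustive_PE_candidate_exists) auto
next
  fix q_exh assume exh: "exhaustive_PE_candidate I p lam mu s q_exh"
  have I: "0 < I"
    using assms(1) zero_less_card_finite[where 'a='k] by linarith
  have rates: "lam k < mu k" for k
    using lam_less_mu assms(3-5) by blast
  obtain \<psi>k where sep: "\<And>x. x \<in> {0..} \<Longrightarrow> \<psi> x = (\<Sum>k\<in>UNIV. \<psi>k k (x $ k))"
    using assms(12) unfolding separable_convex_def by blast
  note \<psi>k = separable_summand_mono_continuous[where \<psi> = \<psi> and \<psi>k = \<psi>k, OF sep assms(9,10)]
  define \<tau> where "\<tau> = cycle_length I lam mu s 1"
  have \<tau>: "0 < \<tau>"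
    using assms(5,7) by (simp add: \<tau>_def cycle_length_def)
  \<comment> \<open>Cycle length is linear in \<open>L\<close>, so \<open>\<tau>\<close> is the time
    per repetition and averages for different \<open>L\<close> can be compared.\<close>
  have \<tau>_L: "cycle_length I lam mu s L = \<tau> * L" for L
    by (simp add: \<tau>_def cycle_length_def)
  \<comment> \<open>The cost integral of queue \<open>k\<close> over one exhaustive cycle. It
    depends on the data alone, so all exhaustive candidates have the same average cost.\<close>
  define C where "C k = mu k / (lam k * (mu k - lam k)) *
    primitive (\<psi>k k) ((mu k - lam k) * (lam k / mu k * \<tau>))" for k
  have avg: "average_cost \<psi> (\<tau> * L, q) =
      (\<Sum>k\<in>UNIV. integral {0..\<tau> * L} (\<lambda>u. \<psi>k k (q u $ k))) / (\<tau> * L)"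
    if "PE_candidate_with I p lam mu s L b q" for L b q
    using that unfolding PE_candidate_with_def Let_def \<tau>_L
    by (intro average_cost_separable sep \<psi>k) blast+
  have end_time: "poll_time I s b (Suc (I * L)) = \<tau> * L"
    if "PE_candidate_with I p lam mu s L b q" for L b q
    using that unfolding PE_candidate_with_def Let_def \<tau>_L by simp
  have saw: "sawtooth (\<lambda>u. q u $ k) (poll_time I s b) (\<lambda>i. poll_time I s b i + b i) (I * L)
      {i\<in>{1..I * L}. periodic_ext I p i = k} (lam k) (mu k)"
    if "PE_candidate_with I p lam mu s L b q" for L b q k
    using that assms(3,6) rates I by (intro PE_candidate_sawtooth) auto
  have exh_cost: "average_cost \<psi> (\<tau>, q_exh) = (\<Sum>k\<in>UNIV. C k) / \<tau>"
    and exh_mem: "(\<tau>, q_exh) \<in> PE_candidates I p lam mu s"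
  proof -
    from exh obtain b where b: "PE_candidate_with I p lam mu s 1 b q_exh"
      and empty: "\<And>i. i \<in> {1..I} \<Longrightarrow> q_exh (poll_time I s b i + b i) $ p i = 0"
      unfolding exhaustive_PE_candidate_def by blast
    show "(\<tau>, q_exh) \<in> PE_candidates I p lam mu s"
      unfolding PE_candidates_def \<tau>_def using b by blast
    have "integral {0..\<tau>} (\<lambda>u. \<psi>k k (q_exh u $ k)) = C k" for k
    proof -
      interpret sawtooth "\<lambda>u. q_exh u $ k" "poll_time I s b" "\<lambda>i. poll_time I s b i + b i" "I * 1"
        "{i\<in>{1..I * 1}. periodic_ext I p i = k}" "lam k" "mu k"
        using b by (rule saw)
      obtain j where j: "{i\<in>{1..I * 1}. periodic_ext I p i = k} = {j}"
        using card_visits[OF assms(11) I, of 1 k] by (rule card_1_singletonE)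
      then have "j \<in> {i\<in>{1..I * 1}. periodic_ext I p i = k}"
        by blast
      then have "j \<in> {1..I}" "p j = k"
        by auto
      then show ?thesis
        using cost_integral_exhaustive[OF \<psi>k(2) j] empty[of j] end_time[OF b]
        by (simp add: C_def)
    qed
    then show "average_cost \<psi> (\<tau>, q_exh) = (\<Sum>k\<in>UNIV. C k) / \<tau>"
      using avg[OF b] by simp
  qed
  have "(\<Sum>k\<in>UNIV. C k) / \<tau> \<le> average_cost \<psi> e"
    if "e \<in> PE_candidates I p lam mu s" for e
  proof -
    from that obtain L b q where e: "e = (\<tau> * L, q)" and L: "1 \<le> L"
      and q: "PE_candidate_with I p lam mu s L b q"
      unfolding PE_candidates_def \<tau>_L by blast
    \<comment> \<open>Each queue separately costs at least \<open>L\<close> exhaustive cycles; after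
      summing over the queues, dividing by \<open>\<tau> * L\<close> cancels
      \<open>L\<close>.\<close>
    have "L * C k \<le> integral {0..\<tau> * L} (\<lambda>u. \<psi>k k (q u $ k))" for k
    proof -
      interpret sawtooth "\<lambda>u. q u $ k" "poll_time I s b" "\<lambda>i. poll_time I s b i + b i" "I * L"
        "{i\<in>{1..I * L}. periodic_ext I p i = k}" "lam k" "mu k"
        using q by (rule saw)
      show ?thesis
        using cost_integral_lower_bound[OF \<psi>k(2,1) card_visits[OF assms(11) I], of \<tau> k]
          end_time[OF q] \<tau> by (simp add: C_def)
    qed
    then have "L * (\<Sum>k\<in>UNIV. C k) \<le> (\<Sum>k\<in>UNIV. integral {0..\<tau> * L} (\<lambda>u. \<psi>k k (q u $ k)))"
      by (simp add: sum_distrib_left sum_mono)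
    then show ?thesis
      unfolding e avg[OF q] using L \<tau> by (simp add: field_simps)
  qed
  then show "is_arg_min (average_cost \<psi>) (\<lambda>e. e \<in> PE_candidates I p lam mu s)
      (cycle_length I lam mu s 1, q_exh)"
    using exh_cost exh_mem unfolding is_arg_min_def \<tau>_def[symmetric] by (auto simp: not_less)
qed

end
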